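(* There are absolute constants $c_0,c>0$ such that for every $\epsilon>0$ there exists $\delta>0$ for which the following holds. For all $\gamma,\alpha,\xi\in(0,c_0]$ and every integer $d\ge 1/\gamma^2$: every $(\epsilon,\delta)$-DP $(\gamma,0)$-robust learner (possibly improper) in dimension $d$, with accuracy parameter $\alpha$ and failure probability $\xi$, has sample complexity $$n\ \ge\ \frac{c}{\epsilon\gamma^2}.$$ (In particular the bound holds already for dimension $d=\lceil 1/\gamma^2\rceil=O(1/\gamma^2)$.)
   Context: Let $\mathbb{B}^d=\{\mathbf{x}\in\mathbb{R}^d:\|\mathbf{x}\|_2\le 1\}$. For $\mathbf{w}\in\mathbb{R}^d$ the halfspace $h_{\mathbf{w}}:\mathbb{B}^d\to\{\pm1\}$ is $h_{\mathbf{w}}(\mathbf{x})=\operatorname{sgn}(\langle \mathbf{w},\mathbf{x}\rangle)$, with $\operatorname{sgn}(t)=+1$ for $t\ge 0$ and $-1$ for $t<0$. For $\gamma\ge 0$, a hypothesis $h:\mathbb{B}^d\to\{\pm1\}$ and a distribution $\mathcal{D}$ on $\mathbb{B}^d\times\{\pm1\}$, the robust risk is $\mathcal{R}_\gamma(h,\mathcal{D})=\Pr_{(\mathbf{x},y)\sim\mathcal{D}}[\exists \mathbf{z}\in\mathbb{B}^d:\ \|\mathbf{z}-\mathbf{x}\|_2\le\gamma,\ h(\mathbf{z})\ne y]$ (so $\mathcal{R}_0(h,\mathcal{D})=\Pr[h(\mathbf{x})\neq y]$). $\mathcal{D}$ is $\gamma$-realizable if there is $\mathbf{w}^*\in\mathbb{R}^d$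 with $\mathcal{R}_\gamma(h_{\mathbf{w}^*},\mathcal{D})=0$. A learner is a randomized algorithm $\mathbb{A}$ that takes a finite dataset (of any size) of labelled points in $\mathbb{B}^d\times\{\pm1\}$ and outputs a hypothesis $h:\mathbb{B}^d\to\{\pm1\}$. It is a $(\gamma,\gamma')$-robust learner with accuracy $\alpha$, failure probability $\xi$ and sample complexity $n$ if, for every $\gamma$-realizable $\mathcal{D}$, when run on $n$ i.i.d. samples from $\mathcal{D}$ it outputs, with probability at least $1-\xi$, a hypothesis $h$ with $\mathcal{R}_{\gamma'}(h,\mathcal{D})\le\alpha$. It is proper if its output is always a halfspace $h_{\mathbf{w}}$; otherwise it is improper. Relevant events are assumed measurable. Two datasets are neighbors if one results from the other by adding or removing a single data point. A randomized algorithm $\mathbb{A}$ is $(\epsilon,\delta)$-DP if for all neighboring datasets $\mathbf{X},\mathbf{X}'$ and all sets $S$ of outputs, $\Pr[\mathbb{A}(\mathbf{X})\in S]\le e^{\epsilon}\Pr[\mathbb{A}(\mathbf{X}')\in S]+\delta$. *)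

theory Defs
  imports "HOL-Probability.Probability"
begin

text \<open>
  The constants in the theorem must not depend on the dimension, so \<open>d\<close> is a natural number and
  vectors in \<open>d\<close>-space are the extensional functions on \<open>{..<d}\<close>, i.e. the space of
  \<open>\<Pi>\<^sub>M i\<in>{..<d}. borel\<close>. Extensionality makes equality of such functions equality of vectors.
\<close>

definition unit_ball :: "nat \<Rightarrow> (nat \<Rightarrow> real) set" where
  "unit_ball d = {x \<in> {..<d} \<rightarrow>\<^sub>E UNIV. L2_set x {..<d} \<le> 1}"

definition example_space :: "nat \<Rightarrow> ((nat \<Rightarrow> real) \<times> int) measure" where
  "example_space d =
     restrict_space (\<Pi>\<^sub>M i\<in>{..<d}. borel) (unit_ball d) \<Otimes>\<^sub>M count_space {- 1, 1}"

definition example_distribution :: "nat \<Rightarrow> ((nat \<Rightarrow> real) \<times> int) measure \<Rightarrow> bool" where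
  "example_distribution d D \<longleftrightarrow> prob_space D \<and> sets D = sets (example_space d)"

definition hypotheses :: "nat \<Rightarrow> ((nat \<Rightarrow> real) \<Rightarrow> int) set" where
  "hypotheses d = unit_ball d \<rightarrow>\<^sub>E {- 1, 1}"

text \<open>The sign convention gives \<open>+1\<close> at \<open>0\<close>, unlike the library's \<open>sgn\<close>.\<close>

definition halfspace :: "nat \<Rightarrow> (nat \<Rightarrow> real) \<Rightarrow> (nat \<Rightarrow> real) \<Rightarrow> int" where
  "halfspace d w = (\<lambda>x\<in>unit_ball d. if (\<Sum>i<d. w i * x i) \<ge> 0 then 1 else - 1)"

definition robust_error :: "nat \<Rightarrow> real \<Rightarrow> ((nat \<Rightarrow> real) \<Rightarrow> int) \<Rightarrow> (nat \<Rightarrow> real) \<times> int \<Rightarrow> bool" where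
  "robust_error d \<gamma> h = (\<lambda>(x, y). \<exists>z\<in>unit_ball d. L2_set (\<lambda>i. z i - x i) {..<d} \<le> \<gamma> \<and> h z \<noteq> y)"

definition robust_risk ::
  "nat \<Rightarrow> real \<Rightarrow> ((nat \<Rightarrow> real) \<Rightarrow> int) \<Rightarrow> ((nat \<Rightarrow> real) \<times> int) measure \<Rightarrow> real" where
  "robust_risk d \<gamma> h D = \<P>(p in D. robust_error d \<gamma> h p)"

text \<open>
  For a halfspace the robust error event is a countable union of closed sets, hence measurable, so
  the risk below is a genuine probability without further assumptions.
\<close>

definition realizable :: "nat \<Rightarrow> real \<Rightarrow> ((nat \<Rightarrow> real) \<times> int) measure \<Rightarrow> bool" where
  "realizable d \<gamma> D \<longleftrightarrow> (\<exists>w \<in> {..<d} \<rightarrow>\<^sub>E UNIV. robust_risk d \<gamma> (halfspace d w) D = 0)"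

definition datasets :: "nat \<Rightarrow> ((nat \<Rightarrow> real) \<times> int) list set" where
  "datasets d = lists (unit_ball d \<times> {- 1, 1})"

text \<open>
  A learner is a family of Markov kernels, one for each dataset size, into a measurable space \<open>H\<close>
  of hypotheses. The \<open>\<sigma>\<close>-algebra of \<open>H\<close> is a parameter, and \<open>space H\<close> may be smaller than the set
  of all hypotheses, so that hypotheses with non-measurable error events can be left out.
\<close>

definition learner ::
  "nat \<Rightarrow> ((nat \<Rightarrow> real) \<Rightarrow> int) measure \<Rightarrow>
   (((nat \<Rightarrow> real) \<times> int) list \<Rightarrow> ((nat \<Rightarrow> real) \<Rightarrow> int) measure) \<Rightarrow> bool" where
  "learner d H A \<longleftrightarrow> space H \<subseteq> hypotheses d \<and>
     (\<forall>n. (\<lambda>X. A (map X [0..<n])) \<in> (\<Pi>\<^sub>M i\<in>{..<n}. example_space d) \<rightarrow>\<^sub>M prob_algebra H)"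

text \<open>The first two conjuncts are the measurability of the events whose probabilities are taken.\<close>

definition robust_learner ::
  "nat \<Rightarrow> real \<Rightarrow> real \<Rightarrow> real \<Rightarrow> real \<Rightarrow> nat \<Rightarrow> ((nat \<Rightarrow> real) \<Rightarrow> int) measure \<Rightarrow>
   (((nat \<Rightarrow> real) \<times> int) list \<Rightarrow> ((nat \<Rightarrow> real) \<Rightarrow> int) measure) \<Rightarrow> bool" where
  "robust_learner d \<gamma> \<gamma>' \<alpha> \<xi> n H A \<longleftrightarrow>
     (\<forall>h\<in>space H. {p \<in> space (example_space d). robust_error d \<gamma>' h p} \<in> sets (example_space d)) \<and>
     (\<forall>D. example_distribution d D \<and> realizable d \<gamma> D \<longrightarrow>
        {h \<in> space H. robust_risk d \<gamma>' h D \<le> \<alpha>} \<in> sets H \<and>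
        measure ((\<Pi>\<^sub>M i\<in>{..<n}. D) \<bind> (\<lambda>X. A (map X [0..<n])))
          {h \<in> space H. robust_risk d \<gamma>' h D \<le> \<alpha>} \<ge> 1 - \<xi>)"

definition add_one :: "'a list \<Rightarrow> 'a list \<Rightarrow> bool" where
  "add_one X X' \<longleftrightarrow> (\<exists>ys zs p. X = ys @ zs \<and> X' = ys @ p # zs)"

definition neighbors :: "'a list \<Rightarrow> 'a list \<Rightarrow> bool" where
  "neighbors X X' \<longleftrightarrow> add_one X X' \<or> add_one X' X"

definition differentially_private ::
  "real \<Rightarrow> real \<Rightarrow> nat \<Rightarrow> ((nat \<Rightarrow> real) \<Rightarrow> int) measure \<Rightarrow>
   (((nat \<Rightarrow> real) \<times> int) list \<Rightarrow> ((nat \<Rightarrow> real) \<Rightarrow> int) measure) \<Rightarrow> bool" where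
  "differentially_private \<epsilon> \<delta> d H A \<longleftrightarrow>
     (\<forall>X\<in>datasets d. \<forall>X'\<in>datasets d. neighbors X X' \<longrightarrow>
        (\<forall>S\<in>sets H. measure (A X) S \<le> exp \<epsilon> * measure (A X') S + \<delta>))"

end

theory Submission
  imports Defs
begin

text \<open>
  Choose \<open>k < 1 / \<gamma>\<^sup>2\<close> of order \<open>1 / \<gamma>\<^sup>2\<close>. Every labelling of \<open>k\<close> orthonormal vectors has margin greater
  than \<open>\<gamma>\<close>, so the learner must predict almost all labels of a random labelling from uniform samples.
  If \<open>n\<close> is small compared to \<open>k / \<epsilon>\<close>, then a typical vector occurs fewer than \<open>1 / (2 * \<epsilon>)\<close> times in the
  sample, so flipping its label changes the probability of a given prediction by at most a constant
  factor, up to an additive term \<open>O(\<delta> / \<epsilon>)\<close>; hence neither label is predicted reliably.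
\<close>

section \<open>Privacy for datasets at a given Hamming distance\<close>

lemma neighbors_insert: "neighbors (us @ xs) (us @ x # xs)"
  unfolding neighbors_def add_one_def by blast

lemma neighbors_remove: "neighbors (us @ x # xs) (us @ xs)"
  unfolding neighbors_def add_one_def by blast

lemma differentially_privateD:
  assumes "differentially_private \<epsilon> \<delta> d H A" "X \<in> datasets d" "X' \<in> datasets d"
    "neighbors X X'" "S \<in> sets H"
  shows "measure (A X) S \<le> exp \<epsilon> * measure (A X') S + \<delta>"
  using assms unfolding differentially_private_def by blast

text \<open>Replacing one entry costs two neighbor steps, a removal and an insertion.\<close>

lemma differentially_private_hamming:
  assumes dp: "differentially_private \<epsilon> \<delta> d H A" and "\<epsilon> > 0" "\<delta> > 0" and S: "S \<in> sets H"
    and "length xs = length ys" "us @ xs \<in> datasets d" "us @ ys \<in> datasets d"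
    and "N = length (filter (\<lambda>(x, y). x \<noteq> y) (zip xs ys))"
  shows "measure (A (us @ xs)) S
    \<le> exp (2 * real N * \<epsilon>) * (measure (A (us @ ys)) S + 2 * real N * \<delta>)"
  using assms(5-)
proof (induction xs ys arbitrary: us N rule: list_induct2)
  case Nil
  then show ?case by simp
next
  case (Cons x xs y ys)
  define M where "M = length (filter (\<lambda>(x, y). x \<noteq> y) (zip xs ys))"
  \<comment> \<open>The position just replaced joins the common prefix, so the hypothesis compares
    \<open>y # xs\<close> with \<open>y # ys\<close>.\<close>
  have IH: "measure (A ((us @ [y]) @ xs)) S
      \<le> exp (2 * real M * \<epsilon>) * (measure (A ((us @ [y]) @ ys)) S + 2 * real M * \<delta>)"
    by (rule Cons.IH) (use Cons.prems in \<open>auto simp: datasets_def M_def\<close>)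
  show ?case
  proof (cases "x = y")
    case True
    then have "N = M" using Cons.prems by (simp add: M_def)
    then show ?thesis using IH True by simp
  next
    case False
    then have N: "N = Suc M" using Cons.prems by (simp add: M_def)
    have d1: "measure (A (us @ x # xs)) S \<le> exp \<epsilon> * measure (A (us @ xs)) S + \<delta>"
      by (rule differentially_privateD[OF dp])
        (use Cons.prems S in \<open>auto simp: datasets_def intro: neighbors_remove\<close>)
    have d2: "measure (A (us @ xs)) S \<le> exp \<epsilon> * measure (A (us @ y # xs)) S + \<delta>"
      by (rule differentially_privateD[OF dp])
        (use Cons.prems S in \<open>auto simp: datasets_def intro: neighbors_insert\<close>)
    define a where "a = measure (A (us @ y # ys)) S"
    define E where "E = exp (2 * real M * \<epsilon>)"
    have E1: "1 \<le> E" and e1: "1 \<le> exp \<epsilon>"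
      using \<open>\<epsilon> > 0\<close> by (auto simp: E_def)
    have EN: "exp (2 * real N * \<epsilon>) = exp \<epsilon> * exp \<epsilon> * E"
      by (simp add: N E_def algebra_simps flip: exp_add)
    have "measure (A (us @ x # xs)) S \<le> exp \<epsilon> * (exp \<epsilon> * (E * (a + 2 * real M * \<delta>)) + \<delta>) + \<delta>"
    proof (rule order_trans[OF d1], intro add_mono mult_left_mono order_trans[OF d2])
      show "measure (A (us @ y # xs)) S \<le> E * (a + 2 * real M * \<delta>)"
        using IH by (simp add: E_def a_def)
    qed auto
    also have "\<dots> = exp \<epsilon> * exp \<epsilon> * E * (a + 2 * real M * \<delta>) + (exp \<epsilon> * \<delta> + \<delta>)"
      by (simp add: algebra_simps)
    \<comment> \<open>Since \<open>exp \<epsilon>\<close> and \<open>E\<close> are at least 1, the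
      additive terms of this replacement are absorbed by the extra \<open>2 * \<delta>\<close> that
      \<open>N = Suc M\<close> puts inside the bracket.\<close>
    also have "exp \<epsilon> * \<delta> + \<delta> \<le> exp \<epsilon> * exp \<epsilon> * E * (2 * \<delta>)"
    proof -
      have "1 \<le> exp \<epsilon> * E"
        using mult_mono[OF e1 E1] by simp
      then have "exp \<epsilon> * 1 \<le> exp \<epsilon> * (exp \<epsilon> * E)"
        by (intro mult_left_mono) auto
      then have "exp \<epsilon> + 1 \<le> 2 * (exp \<epsilon> * (exp \<epsilon> * E))"
        using e1 by linarith
      then have "(exp \<epsilon> + 1) * \<delta> \<le> (2 * (exp \<epsilon> * (exp \<epsilon> * E))) * \<delta>"
        using \<open>\<delta> > 0\<close> by (intro mult_right_mono) auto
      then show ?thesis by (simp add: algebra_simps)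
    qed
    finally show ?thesis
      unfolding EN a_def[symmetric] by (simp add: N algebra_simps)
  qed
qed

section \<open>Labelled orthonormal systems\<close>

text \<open>The restriction to \<open>{..<d}\<close> gives an element of the extensional space. For
  \<open>i \<ge> d\<close> it is the zero vector, so it lies in the unit ball for every
  \<open>i\<close>.\<close>

definition unit_vec :: "nat \<Rightarrow> nat \<Rightarrow> nat \<Rightarrow> real" where
  "unit_vec d i = (\<lambda>j\<in>{..<d}. if j = i then 1 else 0)"

text \<open>\<open>T\<close> is the set of positively labelled indices; the labellings of
  \<open>k\<close> vectors are then the \<open>2 ^ k\<close> elements of
  \<open>Pow {..<k}\<close>.\<close>

definition label :: "nat set \<Rightarrow> nat \<Rightarrow> int" where
  "label T i = (if i \<in> T then 1 else - 1)"

definition labelled_unit_vec :: "nat \<Rightarrow> nat set \<Rightarrow> nat \<Rightarrow> (nat \<Rightarrow> real) \<times> int" where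
  "labelled_unit_vec d T i = (unit_vec d i, label T i)"

text \<open>Two choices of \<open>p\<close> matter: the uniform law on \<open>{..<k}\<close> gives
  the hard instances, and point masses give the measurability of single predictions.\<close>

definition labelled_distribution ::
  "nat \<Rightarrow> nat pmf \<Rightarrow> nat set \<Rightarrow> ((nat \<Rightarrow> real) \<times> int) measure" where
  "labelled_distribution d p T = distr (measure_pmf p) (example_space d) (labelled_unit_vec d T)"

lemma unit_vec_in_unit_ball: "unit_vec d i \<in> unit_ball d"
proof -
  have "L2_set (unit_vec d i) {..<d} = L2_set (\<lambda>j. if j = i then 1 else 0) {..<d}"
    by (intro L2_set_cong) (auto simp: unit_vec_def)
  also have "\<dots> \<le> 1"
    by (simp add: L2_set_def if_distrib[of "\<lambda>x. x\<^sup>2"] cong: if_cong)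
  finally show ?thesis by (auto simp: unit_ball_def unit_vec_def)
qed

lemma space_example_space: "space (example_space d) = unit_ball d \<times> {- 1, 1}"
proof -
  have "unit_ball d \<subseteq> {..<d} \<rightarrow>\<^sub>E UNIV" by (auto simp: unit_ball_def)
  then show ?thesis
    by (auto simp: example_space_def space_pair_measure space_restrict_space space_PiM)
qed

lemma labelled_unit_vec_in_space: "labelled_unit_vec d T i \<in> space (example_space d)"
  by (auto simp: space_example_space labelled_unit_vec_def unit_vec_in_unit_ball label_def)

lemma map_labelled_unit_vec_in_datasets: "map (\<lambda>j. labelled_unit_vec d T (I j)) js \<in> datasets d"
  by (auto simp: datasets_def labelled_unit_vec_def unit_vec_in_unit_ball label_def split: if_splits)

lemma measurable_labelled_unit_vec [measurable]:
  "labelled_unit_vec d T \<in> measurable (measure_pmf p) (example_space d)"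
  by (rule measurableI) (auto intro: labelled_unit_vec_in_space)

lemma example_distribution_labelled: "example_distribution d (labelled_distribution d p T)"
  by (auto simp: example_distribution_def labelled_distribution_def labelled_unit_vec_in_space
      intro!: measure_pmf.prob_space_distr)

section \<open>Risk and realizability of labelled distributions\<close>

lemma robust_risk_labelled:
  assumes "{q \<in> space (example_space d). robust_error d \<gamma> h q} \<in> sets (example_space d)"
  shows "robust_risk d \<gamma> h (labelled_distribution d p T)
    = measure_pmf.prob p {i. robust_error d \<gamma> h (labelled_unit_vec d T i)}"
  using assms labelled_unit_vec_in_space
  by (auto simp: robust_risk_def labelled_distribution_def measure_distr
      intro!: arg_cong[where f="measure (measure_pmf p)"])

lemma robust_error_0_iff:
  assumes "x \<in> unit_ball d"
  shows "robust_error d 0 h (x, y) \<longleftrightarrow> h x \<noteq> y"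
proof -
  have "z = x" if "z \<in> unit_ball d" "L2_set (\<lambda>i. z i - x i) {..<d} \<le> 0" for z
  proof (rule ext)
    fix i
    have "L2_set (\<lambda>i. z i - x i) {..<d} = 0"
      using that by (simp add: antisym)
    then have "\<forall>i<d. z i = x i" by (simp add: L2_set_eq_0_iff)
    \<comment> \<open>Outside \<open>{..<d}\<close> both vectors take the value
      \<open>undefined\<close>.\<close>
    then show "z i = x i"
      using that assms by (cases "i < d") (auto simp: unit_ball_def PiE_def extensional_def)
  qed
  then show ?thesis using assms unfolding robust_error_def by (auto simp: L2_set_def intro!: bexI[of _ x])
qed

text \<open>
  The halfspace with normal vector \<open>\<Sum>i<k. label T i *\<^sub>R unit_vec d i\<close>, whose norm is \<open>sqrt k\<close>, has
  margin \<open>1 / sqrt k > \<gamma>\<close>.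
\<close>

lemma realizable_labelled:
  assumes "\<gamma> > 0" "real k * \<gamma>\<^sup>2 < 1" "k \<le> d" "set_pmf p \<subseteq> {..<k}"
  shows "realizable d \<gamma> (labelled_distribution d p T)"
proof -
  define w :: "nat \<Rightarrow> real" where
    "w = (\<lambda>j\<in>{..<d}. if j < k then of_int (label T j) else 0)"
  have w2: "L2_set w {..<d} = sqrt (real k)"
  proof -
    have "(\<Sum>j<d. (w j)\<^sup>2) = (\<Sum>j<d. if j < k then 1 else 0)"
      by (intro sum.cong) (auto simp: w_def label_def)
    also have "\<dots> = (\<Sum>j | j \<in> {..<d} \<and> j < k. 1)"
      by (subst sum.inter_filter) auto
    also have "{j. j \<in> {..<d} \<and> j < k} = {..<k}" using assms by auto
    finally show ?thesis by (simp add: L2_set_def)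
  qed
  have no_err: "\<not> robust_error d \<gamma> (halfspace d w) (labelled_unit_vec d T i)" if "i < k" for i
  proof -
    have "halfspace d w z = label T i"
      if z: "z \<in> unit_ball d" "L2_set (\<lambda>j. z j - unit_vec d i j) {..<d} \<le> \<gamma>" for z
    proof -
      \<comment> \<open>By Cauchy-Schwarz, moving from \<open>unit_vec d i\<close> to
        \<open>z\<close> changes the inner product with \<open>w\<close> by less than 1, while its
        value at \<open>unit_vec d i\<close> is 1 or -1. Strictness keeps it away from 0, where
        \<open>halfspace\<close> answers 1 even if the label is -1.\<close>
      have "\<bar>\<Sum>j<d. w j * (z j - unit_vec d i j)\<bar>
          \<le> (\<Sum>j<d. \<bar>w j\<bar> * \<bar>z j - unit_vec d i j\<bar>)"
        by (rule order_trans[OF sum_abs]) (simp add: abs_mult)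
      also have "\<dots> \<le> L2_set w {..<d} * L2_set (\<lambda>j. z j - unit_vec d i j) {..<d}"
        by (rule L2_set_mult_ineq)
      also have "\<dots> \<le> sqrt (real k) * \<gamma>"
        unfolding w2 using z by (intro mult_left_mono) auto
      also have "sqrt (real k) * \<gamma> = sqrt (real k * \<gamma>\<^sup>2)"
        using assms by (simp add: real_sqrt_mult)
      also have "\<dots> < 1" using assms by simp
      finally have less: "\<bar>\<Sum>j<d. w j * (z j - unit_vec d i j)\<bar> < 1" .
      have "(\<Sum>j<d. w j * unit_vec d i j) = (\<Sum>j<d. if j = i then w j else 0)"
        by (intro sum.cong) (auto simp: unit_vec_def)
      also have "\<dots> = of_int (label T i)"
        using \<open>i < k\<close> \<open>k \<le> d\<close> by (simp add: w_def)
      finally have "(\<Sum>j<d. w j * (z j - unit_vec d i j)) = (\<Sum>j<d. w j * z j) - of_int (label T i)"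
        by (simp add: right_diff_distrib sum_subtractf)
      with less z show ?thesis
        by (auto simp: halfspace_def label_def split: if_splits)
    qed
    then show ?thesis by (auto simp: robust_error_def labelled_unit_vec_def)
  qed
  have "robust_risk d \<gamma> (halfspace d w) (labelled_distribution d p T) = 0"
  proof (cases "{q \<in> space (example_space d). robust_error d \<gamma> (halfspace d w) q}
      \<in> sets (example_space d)")
    case True
    have "measure_pmf.prob p {i. robust_error d \<gamma> (halfspace d w) (labelled_unit_vec d T i)} = 0"
      using no_err assms(4) by (subst measure_pmf_zero_iff) auto
    then show ?thesis by (simp add: robust_risk_labelled[OF True])
  next
    \<comment> \<open>\<open>measure\<close> is 0 on sets outside the sigma-algebra, so the risk
      vanishes here too; the case split replaces a measurability proof for the error event.\<close>
    case False
    then show ?thesis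
      by (auto simp: robust_risk_def labelled_distribution_def intro!: measure_notin_sets)
  qed
  moreover have "w \<in> {..<d} \<rightarrow>\<^sub>E UNIV" by (auto simp: w_def)
  ultimately show ?thesis unfolding realizable_def by blast
qed

section \<open>The learner on labelled orthonormal systems\<close>

text \<open>Transfers the kernel condition, which speaks of index functions, to individual lists: a
  dataset of length \<open>n\<close> is read as a point of the \<open>n\<close>-fold product
  space.\<close>

lemma learner_prob_space:
  assumes "learner d H A" "X \<in> datasets d"
  shows "prob_space (A X)" "sets (A X) = sets H"
proof -
  define I where "I = (\<lambda>i\<in>{..<length X}. X ! i)"
  have "I \<in> space (\<Pi>\<^sub>M i\<in>{..<length X}. example_space d)"
    using assms(2) nth_mem[of _ X]
    by (auto simp: I_def space_PiM space_example_space datasets_def simp del: nth_mem)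
  moreover have "(\<lambda>X. A (map X [0..<n])) \<in> (\<Pi>\<^sub>M i\<in>{..<n}. example_space d) \<rightarrow>\<^sub>M prob_algebra H" for n
    using assms(1) by (auto simp: learner_def)
  ultimately have "A (map I [0..<length X]) \<in> space (prob_algebra H)"
    by (rule measurable_space[rotated])
  also have "map I [0..<length X] = X"
    by (intro nth_equalityI) (auto simp: I_def)
  finally show "prob_space (A X)" "sets (A X) = sets H"
    by (auto simp: space_prob_algebra)
qed

text \<open>Drawing labelled examples independently amounts to drawing indices independently and
  labelling them afterwards. The law of the indices \<open>I\<close> does not depend on
  \<open>T\<close>, which later allows averaging over labellings with \<open>I\<close>
  fixed.\<close>

lemma measure_bind_labelled:
  assumes A: "learner d H A" and S: "S \<in> sets H"
  shows "measure ((\<Pi>\<^sub>M i\<in>{..<n}. labelled_distribution d p T) \<bind> (\<lambda>X. A (map X [0..<n]))) S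
    = (\<integral>I. measure (A (map (\<lambda>j. labelled_unit_vec d T (I j)) [0..<n])) S
        \<partial>(\<Pi>\<^sub>M i\<in>{..<n}. measure_pmf p))"
    and "integrable (\<Pi>\<^sub>M i\<in>{..<n}. measure_pmf p)
      (\<lambda>I. measure (A (map (\<lambda>j. labelled_unit_vec d T (I j)) [0..<n])) S)"
proof -
  let ?D = "labelled_distribution d p T" and ?P = "\<Pi>\<^sub>M i\<in>{..<n}. measure_pmf p"
  let ?f = "labelled_unit_vec d T"
  let ?\<phi> = "compose {..<n} ?f"
  have sets_D: "sets ?D = sets (example_space d)" and D: "prob_space ?D"
    using example_distribution_labelled[of d p T] by (auto simp: example_distribution_def)
  have [measurable_cong]: "sets (\<Pi>\<^sub>M i\<in>{..<n}. ?D) = sets (\<Pi>\<^sub>M i\<in>{..<n}. example_space d)"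
    by (intro sets_PiM_cong) (auto simp: sets_D)
  have f: "?f \<in> measurable (measure_pmf p) ?D"
    unfolding measurable_cong_sets[OF refl sets_D] by (rule measurable_labelled_unit_vec)
  have "distr ?P (\<Pi>\<^sub>M i\<in>{..<n}. ?D) ?\<phi> = (\<Pi>\<^sub>M i\<in>{..<n}. distr (measure_pmf p) ?D ?f)"
    using f D by (intro distr_PiM_finite_prob_space') (auto intro: measure_pmf.prob_space_axioms)
  also have "distr (measure_pmf p) ?D ?f = ?D"
    using sets_D by (auto simp: labelled_distribution_def intro!: distr_cong)
  finally have distr: "distr ?P (\<Pi>\<^sub>M i\<in>{..<n}. ?D) ?\<phi> = (\<Pi>\<^sub>M i\<in>{..<n}. ?D)" .
  interpret P: prob_space ?P
    by (intro prob_space_PiM measure_pmf.prob_space_axioms)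
  interpret Q: prob_space "\<Pi>\<^sub>M i\<in>{..<n}. ?D"
    using D by (intro prob_space_PiM)
  have "(\<lambda>X. A (map X [0..<n])) \<in> (\<Pi>\<^sub>M i\<in>{..<n}. example_space d) \<rightarrow>\<^sub>M prob_algebra H"
    using A by (auto simp: learner_def)
  then have kernel: "(\<lambda>X. A (map X [0..<n])) \<in> (\<Pi>\<^sub>M i\<in>{..<n}. ?D) \<rightarrow>\<^sub>M subprob_algebra H"
    by (intro measurable_prob_algebraD) measurable
  have m: "(\<lambda>X. measure (A (map X [0..<n])) S) \<in> borel_measurable (\<Pi>\<^sub>M i\<in>{..<n}. ?D)"
    using measurable_compose[OF kernel measurable_measure_subprob_algebra[OF S]] .
  have \<phi>: "?\<phi> \<in> ?P \<rightarrow>\<^sub>M (\<Pi>\<^sub>M i\<in>{..<n}. ?D)"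
    unfolding compose_def
    by (intro measurable_restrict measurable_compose[OF _ f] measurable_component_singleton)
  have eq: "map (?\<phi> I) [0..<n] = map (\<lambda>j. ?f (I j)) [0..<n]" for I
    by (auto simp: compose_def)
  have "measure ((\<Pi>\<^sub>M i\<in>{..<n}. ?D) \<bind> (\<lambda>X. A (map X [0..<n]))) S
      = (\<integral>X. measure (A (map X [0..<n])) S \<partial>(\<Pi>\<^sub>M i\<in>{..<n}. ?D))"
    by (rule Q.measure_bind[OF kernel S])
  also have "\<dots> = (\<integral>X. measure (A (map X [0..<n])) S \<partial>(distr ?P (\<Pi>\<^sub>M i\<in>{..<n}. ?D) ?\<phi>))"
    by (simp only: distr)
  also have "\<dots> = (\<integral>I. measure (A (map (?\<phi> I) [0..<n])) S \<partial>?P)"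
    by (rule integral_distr[OF \<phi> m])
  finally show "measure ((\<Pi>\<^sub>M i\<in>{..<n}. ?D) \<bind> (\<lambda>X. A (map X [0..<n]))) S
    = (\<integral>I. measure (A (map (\<lambda>j. ?f (I j)) [0..<n])) S \<partial>?P)"
    by (simp only: eq)
  have "(\<lambda>I. measure (A (map (?\<phi> I) [0..<n])) S) \<in> borel_measurable ?P"
    using measurable_compose[OF \<phi> m] .
  then have meas: "(\<lambda>I. measure (A (map (\<lambda>j. ?f (I j)) [0..<n])) S) \<in> borel_measurable ?P"
    by (simp only: eq)
  have "prob_space (A (map (\<lambda>j. ?f (I j)) [0..<n]))" for I
    by (rule learner_prob_space(1)[OF A map_labelled_unit_vec_in_datasets])
  then show "integrable ?P (\<lambda>I. measure (A (map (\<lambda>j. ?f (I j)) [0..<n])) S)"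
    by (intro P.integrable_const_bound[where B=1] meas) (auto intro!: prob_space.prob_le_1 AE_I2)
qed

text \<open>
  The point mass at \<open>(unit_vec d i, y)\<close> is realizable, and a hypothesis has risk at most \<open>\<alpha> < 1\<close>
  for it iff it maps \<open>unit_vec d i\<close> to \<open>y\<close>.
\<close>

lemma sets_predict_label:
  assumes A: "robust_learner d \<gamma> 0 \<alpha> \<xi> n H A"
    and "\<gamma> > 0" "real k * \<gamma>\<^sup>2 < 1" "k \<le> d" "i < k" "0 < \<alpha>" "\<alpha> < 1"
  shows "{h \<in> space H. h (unit_vec d i) = label T i} \<in> sets H"
proof -
  let ?D = "labelled_distribution d (return_pmf i) T"
  have "realizable d \<gamma> ?D"
    using assms by (intro realizable_labelled[where k=k]) auto
  then have "{h \<in> space H. robust_risk d 0 h ?D \<le> \<alpha>} \<in> sets H"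
    using A example_distribution_labelled unfolding robust_learner_def by blast
  also have "{h \<in> space H. robust_risk d 0 h ?D \<le> \<alpha>}
      = {h \<in> space H. h (unit_vec d i) = label T i}"
  proof (intro Collect_cong conj_cong refl)
    fix h assume "h \<in> space H"
    then have "{p \<in> space (example_space d). robust_error d 0 h p} \<in> sets (example_space d)"
      using A unfolding robust_learner_def by blast
    from robust_risk_labelled[OF this] assms
    show "robust_risk d 0 h ?D \<le> \<alpha> \<longleftrightarrow> h (unit_vec d i) = label T i"
      by (auto simp: labelled_unit_vec_def robust_error_0_iff unit_vec_in_unit_ball indicator_def)
  qed
  finally show ?thesis .
qed

lemma robust_risk_uniform:
  assumes A: "robust_learner d \<gamma> 0 \<alpha> \<xi> n H A" and "h \<in> space H" "k > 0"
  shows "robust_risk d 0 h (labelled_distribution d (pmf_of_set {..<k}) T)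
    = (\<Sum>i<k. of_bool (h (unit_vec d i) \<noteq> label T i)) / real k"
proof -
  have "{p \<in> space (example_space d). robust_error d 0 h p} \<in> sets (example_space d)"
    using A \<open>h \<in> space H\<close> unfolding robust_learner_def by blast
  from robust_risk_labelled[OF this]
  have "robust_risk d 0 h (labelled_distribution d (pmf_of_set {..<k}) T)
      = measure_pmf.prob (pmf_of_set {..<k}) {i. h (unit_vec d i) \<noteq> label T i}"
    by (simp add: labelled_unit_vec_def robust_error_0_iff unit_vec_in_unit_ball)
  also have "\<dots> = card ({..<k} \<inter> {i. h (unit_vec d i) \<noteq> label T i}) / real k"
    using \<open>k > 0\<close> by (subst measure_pmf_of_set) auto
  also have "real (card ({..<k} \<inter> {i. h (unit_vec d i) \<noteq> label T i}))
      = (\<Sum>i<k. of_bool (h (unit_vec d i) \<noteq> label T i))"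
    by (simp add: of_bool_def sum.If_cases Int_def)
  finally show ?thesis .
qed

section \<open>Flipping a single label\<close>

definition flip :: "nat \<Rightarrow> nat set \<Rightarrow> nat set" where
  "flip i T = (if i \<in> T then T - {i} else insert i T)"

lemma flip_flip [simp]: "flip i (flip i T) = T"
  by (auto simp: flip_def)

lemma label_flip: "label (flip i T) j = (if j = i then - label T j else label T j)"
  by (cases "j = i"; cases "i \<in> T") (simp_all add: flip_def label_def)

text \<open>The two datasets differ exactly at the \<open>count_list js i\<close> occurrences of
  \<open>i\<close>. If \<open>2 * \<epsilon> * count_list js i < 1\<close>, the privacy factor is at
  most \<open>exp 1 \<le> 3\<close> and the additive term at most \<open>3 * (1 / 12)\<close>.
  Otherwise the first summand alone exceeds any probability. This form is linear in the count, so it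
  can be summed over all \<open>i\<close> without separating rare indices.\<close>

lemma predict_label_flip_le:
  assumes A: "learner d H A" and dp: "differentially_private \<epsilon> (\<epsilon> / 12) d H A" and "\<epsilon> > 0"
    and S: "S \<in> sets H"
  shows "measure (A (map (labelled_unit_vec d T) js)) S
    \<le> 2 * \<epsilon> * count_list js i + 3 * measure (A (map (labelled_unit_vec d (flip i T)) js)) S + 1 / 4"
    (is "measure (A ?X) S \<le> 2 * \<epsilon> * real ?N + 3 * measure (A ?Y) S + 1 / 4")
proof (cases "2 * \<epsilon> * ?N \<ge> 1")
  case True
  have "measure (A ?X) S \<le> 1"
    by (intro prob_space.prob_le_1 learner_prob_space[OF A] map_labelled_unit_vec_in_datasets)
  then show ?thesis using True measure_nonneg[of "A ?Y" S] by linarith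
next
  case False
  have X: "map (labelled_unit_vec d U) js \<in> datasets d" for U
    by (rule map_labelled_unit_vec_in_datasets)
  have N: "?N = length (filter (\<lambda>(x, y). x \<noteq> y) (zip ?X ?Y))"
  proof -
    have "zip ?X ?Y = map (\<lambda>j. (labelled_unit_vec d T j, labelled_unit_vec d (flip i T) j)) js"
      by (simp add: zip_map_map zip_same_conv_map)
    moreover have "labelled_unit_vec d T j \<noteq> labelled_unit_vec d (flip i T) j \<longleftrightarrow> i = j" for j
      by (auto simp: labelled_unit_vec_def label_flip) (auto simp: label_def split: if_splits)
    ultimately show ?thesis
      by (simp add: filter_map o_def count_list_eq_length_filter)
  qed
  have "measure (A ([] @ ?X)) S
      \<le> exp (2 * real ?N * \<epsilon>) * (measure (A ([] @ ?Y)) S + 2 * real ?N * (\<epsilon> / 12))"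
    using \<open>\<epsilon> > 0\<close> S X N by (intro differentially_private_hamming[OF dp]) auto
  also have "\<dots> \<le> 3 * (measure (A ?Y) S + 1 / 12)"
  proof (intro mult_mono add_mono)
    have "exp (2 * real ?N * \<epsilon>) \<le> exp 1"
      using False by (simp add: mult_ac)
    then show "exp (2 * real ?N * \<epsilon>) \<le> 3"
      using exp_le by linarith
    show "2 * real ?N * (\<epsilon> / 12) \<le> 1 / 12"
      using False by (simp add: mult_ac)
  qed (use \<open>\<epsilon> > 0\<close> in auto)
  also have "\<dots> \<le> 2 * \<epsilon> * ?N + 3 * measure (A ?Y) S + 1 / 4"
    using \<open>\<epsilon> > 0\<close> by simp
  finally show ?thesis by simp
qed

text \<open>
  Flipping the label of a rarely sampled index hardly changes the probability of predicting either
  value there, and \<open>length js \<le> k / (8 * \<epsilon>)\<close> makes most indices rare.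
\<close>

lemma total_error_ge:
  assumes A: "learner d H A" and dp: "differentially_private \<epsilon> (\<epsilon> / 12) d H A" and "\<epsilon> > 0"
    and S: "\<And>T i. i < k \<Longrightarrow> {h \<in> space H. h (unit_vec d i) = label T i} \<in> sets H"
    and small: "8 * \<epsilon> * length js \<le> k"
  shows "2 ^ k * real k / 8 \<le> (\<Sum>T\<in>Pow {..<k}. \<Sum>i<k.
    measure (A (map (labelled_unit_vec d T) js)) {h \<in> space H. h (unit_vec d i) \<noteq> label T i})"
    (is "_ \<le> (\<Sum>T\<in>_. \<Sum>i<k. ?W T i)")
proof -
  let ?X = "\<lambda>T. map (labelled_unit_vec d T) js"
  have hyp: "h (unit_vec d i) = 1 \<or> h (unit_vec d i) = - 1" if "h \<in> space H" for h i
    using that A unit_vec_in_unit_ball[of d i] by (auto simp: learner_def hypotheses_def PiE_iff)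
  have X: "?X T \<in> datasets d" for T
    by (rule map_labelled_unit_vec_in_datasets)
  \<comment> \<open>With only two possible values, predicting \<open>label T i\<close> is an error
    for \<open>flip i T\<close>. So the correct prediction, of probability
    \<open>1 - ?W T i\<close>, is bounded through the error \<open>?W (flip i T) i\<close>.\<close>
  have step: "3 / 4 \<le> 2 * \<epsilon> * count_list js i + 3 * ?W (flip i T) i + ?W T i" if "i < k" for T i
  proof -
    let ?S = "{h \<in> space H. h (unit_vec d i) = label T i}"
    interpret M: prob_space "A (?X T)" using learner_prob_space[OF A X] by simp
    have sets: "sets (A (?X T)) = sets H" using learner_prob_space[OF A X] by simp
    have "{h \<in> space H. h (unit_vec d i) \<noteq> label T i} = space (A (?X T)) - ?S"
      using sets_eq_imp_space_eq[OF sets] by auto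
    then have "?W T i = 1 - measure (A (?X T)) ?S"
      using S[OF \<open>i < k\<close>] sets by (simp add: M.prob_compl)
    moreover have "?S = {h \<in> space H. h (unit_vec d i) \<noteq> label (flip i T) i}"
      unfolding label_flip using hyp[of _ i] by (auto simp: label_def)
    ultimately show ?thesis
      using predict_label_flip_le[OF A dp \<open>\<epsilon> > 0\<close> S[OF \<open>i < k\<close>, of T], of T js i] by simp
  qed
  \<comment> \<open>For \<open>i < k\<close>, \<open>flip i\<close> is an involution of
    \<open>Pow {..<k}\<close>, so averaging over all labellings identifies the two kinds of
    error.\<close>
  have flip: "(\<Sum>T\<in>Pow {..<k}. ?W (flip i T) i) = (\<Sum>T\<in>Pow {..<k}. ?W T i)" if "i < k" for i
    using that by (intro sum.reindex_bij_witness[where i="flip i" and j="flip i"])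
      (auto simp: flip_def split: if_splits)
  \<comment> \<open>Entries of \<open>js\<close> outside \<open>{..<k}\<close> are counted on the
    right only.\<close>
  have "(\<Sum>i<k. count_list js i) \<le> (\<Sum>i\<in>{..<k} \<union> set js. count_list js i)"
    by (intro sum_mono2) auto
  also have "\<dots> = length js"
    by (intro sum_count_set) auto
  finally have count: "(\<Sum>i<k. real (count_list js i)) \<le> length js"
    by (simp flip: of_nat_sum)
  \<comment> \<open>Summing \<open>step\<close> over \<open>i\<close> and \<open>T\<close> gives
    four times the total error plus at most \<open>2 ^ k * k / 4\<close> from the counts; the
    remaining \<open>2 ^ k * k / 2\<close> is divided by 4.\<close>
  have "(2 ^ k * real k) * (3 / 4) = (\<Sum>i<k. \<Sum>T\<in>Pow {..<k}. 3 / 4)"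
    by (simp add: card_Pow)
  also have "\<dots> \<le> (\<Sum>i<k. \<Sum>T\<in>Pow {..<k}.
      2 * \<epsilon> * count_list js i + 3 * ?W (flip i T) i + ?W T i)"
    using step by (intro sum_mono) auto
  also have "\<dots> = (\<Sum>i<k. 2 ^ k * (2 * \<epsilon> * count_list js i)
      + 3 * (\<Sum>T\<in>Pow {..<k}. ?W (flip i T) i) + (\<Sum>T\<in>Pow {..<k}. ?W T i))"
    by (simp add: sum.distrib card_Pow flip: sum_distrib_left)
  also have "\<dots> = (\<Sum>i<k. (2 ^ k * (2 * \<epsilon>)) * count_list js i + 4 * (\<Sum>T\<in>Pow {..<k}. ?W T i))"
    by (intro sum.cong) (simp_all add: flip)
  also have "\<dots> = (2 ^ k * (2 * \<epsilon>)) * (\<Sum>i<k. real (count_list js i))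
      + 4 * (\<Sum>i<k. \<Sum>T\<in>Pow {..<k}. ?W T i)"
    by (simp add: sum.distrib sum_distrib_left)
  also have "\<dots> \<le> (2 ^ k * (2 * \<epsilon>)) * length js + 4 * (\<Sum>i<k. \<Sum>T\<in>Pow {..<k}. ?W T i)"
    using count \<open>\<epsilon> > 0\<close> by (intro add_mono mult_left_mono) auto
  also have "(2 ^ k * (2 * \<epsilon>)) * length js \<le> 2 ^ k * (k / 4)"
    using small by (simp add: mult.assoc)
  also have "(\<Sum>i<k. \<Sum>T\<in>Pow {..<k}. ?W T i) = (\<Sum>T\<in>Pow {..<k}. \<Sum>i<k. ?W T i)"
    by (rule sum.swap)
  finally show ?thesis by (simp add: mult.commute)
qed

section \<open>Averaging over labellings\<close>

lemma robust_risk_sets: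
  assumes "robust_learner d \<gamma> \<gamma>' \<alpha> \<xi> n H A" "example_distribution d D" "realizable d \<gamma> D"
  shows "{h \<in> space H. robust_risk d \<gamma>' h D \<le> \<alpha>} \<in> sets H"
    and "1 - \<xi> \<le> measure ((\<Pi>\<^sub>M i\<in>{..<n}. D) \<bind> (\<lambda>X. A (map X [0..<n])))
      {h \<in> space H. robust_risk d \<gamma>' h D \<le> \<alpha>}"
  using assms unfolding robust_learner_def by blast+

text \<open>A hypothesis in \<open>?G\<close> errs on at most \<open>\<alpha> * k\<close> indices,
  any other on at most \<open>k\<close>. Both bounds are covered by
  \<open>k * (1 + \<alpha> - indicator ?G h)\<close>, which is then integrated over
  \<open>M\<close>.\<close>

lemma sum_prob_errors_le:
  assumes A: "robust_learner d \<gamma> 0 \<alpha> \<xi> n H A" and M: "prob_space M" "sets M = sets H"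
    and "k > 0" "\<alpha> \<ge> 0"
    and S: "\<And>i. i < k \<Longrightarrow> {h \<in> space H. h (unit_vec d i) = label T i} \<in> sets H"
    and G: "{h \<in> space H. robust_risk d 0 h (labelled_distribution d (pmf_of_set {..<k}) T) \<le> \<alpha>}
      \<in> sets H" (is "?G \<in> _")
  shows "(\<Sum>i<k. measure M {h \<in> space H. h (unit_vec d i) \<noteq> label T i})
    \<le> real k * (1 + \<alpha> - measure M ?G)"
proof -
  interpret M: prob_space M by fact
  let ?E = "\<lambda>i. {h \<in> space H. h (unit_vec d i) \<noteq> label T i}"
  have space: "space M = space H" using M(2) by (rule sets_eq_imp_space_eq)
  have E: "?E i \<in> sets M" if "i < k" for i
  proof -
    have "?E i = space H - {h \<in> space H. h (unit_vec d i) = label T i}" by auto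
    then show ?thesis using S[OF that] M(2) by simp
  qed
  have int: "integrable M (indicator B :: _ \<Rightarrow> real)" if "B \<in> sets M" for B
    using that by (intro integrable_real_indicator) (auto simp: less_top[symmetric])
  have "(\<Sum>i<k. measure M (?E i)) = (\<Sum>i<k. \<integral>h. indicator (?E i) h \<partial>M)"
    using E by (intro sum.cong) (auto simp: sets.Int_space_eq2)
  also have "\<dots> = (\<integral>h. (\<Sum>i<k. indicator (?E i) h) \<partial>M)"
    using E int by (intro Bochner_Integration.integral_sum[symmetric]) auto
  also have "\<dots> \<le> (\<integral>h. real k * (1 + \<alpha> - indicator ?G h) \<partial>M)"
  proof (rule integral_mono)
    show "integrable M (\<lambda>h. (\<Sum>i<k. indicator (?E i) h) :: real)"
      using E int by (intro Bochner_Integration.integrable_sum) auto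
    show "integrable M (\<lambda>h. real k * (1 + \<alpha> - indicator ?G h))"
      using G int M(2) by auto
    fix h assume "h \<in> space M"
    then have h: "h \<in> space H" using space by simp
    have eq: "(\<Sum>i<k. indicator (?E i) h) = (\<Sum>i<k. of_bool (h (unit_vec d i) \<noteq> label T i) :: real)"
      using h by (intro sum.cong) (auto simp: indicator_def)
    have "(\<Sum>i<k. of_bool (h (unit_vec d i) \<noteq> label T i) :: real) \<le> (\<Sum>i<k. 1)"
      by (intro sum_mono) auto
    then have le: "(\<Sum>i<k. of_bool (h (unit_vec d i) \<noteq> label T i) :: real) \<le> real k"
      by simp
    have risk: "(\<Sum>i<k. of_bool (h (unit_vec d i) \<noteq> label T i) :: real)
        = real k * robust_risk d 0 h (labelled_distribution d (pmf_of_set {..<k}) T)"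
      using robust_risk_uniform[OF A h \<open>k > 0\<close>, of T] \<open>k > 0\<close> by simp
    show "(\<Sum>i<k. indicator (?E i) h) \<le> real k * (1 + \<alpha> - indicator ?G h)"
    proof (cases "h \<in> ?G")
      case True
      then show ?thesis unfolding eq risk by (simp add: mult_left_mono)
    next
      case False
      have "real k \<le> real k * (1 + \<alpha>)"
        using \<open>\<alpha> \<ge> 0\<close> by (simp add: distrib_left)
      with le False show ?thesis unfolding eq by simp
    qed
  qed
  also have "\<dots> = real k * (1 + \<alpha> - measure M ?G)"
    using G M(2) int by (simp add: M.prob_space sets.Int_space_eq2)
  finally show ?thesis .
qed

text \<open>The success probability, averaged over all labellings, is at least
  \<open>1 - \<xi>\<close>; if \<open>8 * \<epsilon> * n \<le> k\<close>, it is also at most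
  \<open>7 / 8 + \<alpha>\<close>, contradicting \<open>\<alpha> + \<xi> < 1 / 8\<close>.\<close>

lemma sample_complexity_orthonormal:
  assumes A: "learner d H A" and dp: "differentially_private \<epsilon> (\<epsilon> / 12) d H A" and "\<epsilon> > 0"
    and rob: "robust_learner d \<gamma> 0 \<alpha> \<xi> n H A"
    and k: "0 < k" "k \<le> d" and "\<gamma> > 0" "real k * \<gamma>\<^sup>2 < 1"
    and "0 < \<alpha>" "\<alpha> + \<xi> < 1 / 8" "\<alpha> < 1"
  shows "real k < 8 * \<epsilon> * n"
proof (rule ccontr)
  assume "\<not> real k < 8 * \<epsilon> * n"
  then have small: "8 * \<epsilon> * n \<le> k" by simp
  let ?p = "pmf_of_set {..<k}"
  let ?P = "\<Pi>\<^sub>M i\<in>{..<n}. measure_pmf ?p"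
  let ?D = "\<lambda>T. labelled_distribution d ?p T"
  let ?G = "\<lambda>T. {h \<in> space H. robust_risk d 0 h (?D T) \<le> \<alpha>}"
  let ?X = "\<lambda>T I. map (\<lambda>j. labelled_unit_vec d T (I j)) [0..<n]"
  interpret P: prob_space ?P
    by (intro prob_space_PiM measure_pmf.prob_space_axioms)
  have S: "{h \<in> space H. h (unit_vec d i) = label T i} \<in> sets H" if "i < k" for T i
    using assms that by (intro sets_predict_label[OF rob, of k]) auto
  have real: "realizable d \<gamma> (?D T)" for T
    using assms by (intro realizable_labelled[of _ k]) (auto simp: lessThan_empty_iff)
  note G = robust_risk_sets[OF rob example_distribution_labelled real]
  have avg: "1 - \<xi> \<le> (\<integral>I. measure (A (?X T I)) (?G T) \<partial>?P)" for T
    using G measure_bind_labelled(1)[OF A] by simp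
  \<comment> \<open>With \<open>I\<close> fixed, the total error over all labellings is bounded
    below by \<open>total_error_ge\<close> and above by \<open>sum_prob_errors_le\<close>;
    cancelling \<open>k\<close> leaves a bound on the success probabilities.\<close>
  have point: "(\<Sum>T\<in>Pow {..<k}. measure (A (?X T I)) (?G T)) \<le> 2 ^ k * (7 / 8 + \<alpha>)" for I
  proof -
    have X: "?X T I \<in> datasets d" for T
      by (rule map_labelled_unit_vec_in_datasets)
    have "2 ^ k * real k / 8 \<le> (\<Sum>T\<in>Pow {..<k}. \<Sum>i<k.
        measure (A (?X T I)) {h \<in> space H. h (unit_vec d i) \<noteq> label T i})"
      using total_error_ge[OF A dp \<open>\<epsilon> > 0\<close> S, where js="map I [0..<n]"] small by (simp add: o_def)
    also have "\<dots> \<le> (\<Sum>T\<in>Pow {..<k}. real k * (1 + \<alpha> - measure (A (?X T I)) (?G T)))"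
      using learner_prob_space[OF A X] k \<open>0 < \<alpha>\<close>
      by (intro sum_mono sum_prob_errors_le[OF rob] S G) auto
    also have "\<dots> = real k * (2 ^ k * (1 + \<alpha>) - (\<Sum>T\<in>Pow {..<k}. measure (A (?X T I)) (?G T)))"
      by (simp add: sum_subtractf card_Pow flip: sum_distrib_left)
    finally have "real k * (2 ^ k / 8)
        \<le> real k * (2 ^ k * (1 + \<alpha>) - (\<Sum>T\<in>Pow {..<k}. measure (A (?X T I)) (?G T)))"
      by (simp add: mult.commute)
    then have "2 ^ k / 8 \<le> 2 ^ k * (1 + \<alpha>) - (\<Sum>T\<in>Pow {..<k}. measure (A (?X T I)) (?G T))"
      using k by (subst (asm) mult_le_cancel_left_pos) auto
    then show ?thesis by (simp add: algebra_simps)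
  qed
  have "2 ^ k * (1 - \<xi>) = (\<Sum>T\<in>Pow {..<k}. 1 - \<xi>)"
    by (simp add: card_Pow)
  also have "\<dots> \<le> (\<Sum>T\<in>Pow {..<k}. \<integral>I. measure (A (?X T I)) (?G T) \<partial>?P)"
    by (intro sum_mono avg)
  also have "\<dots> = (\<integral>I. (\<Sum>T\<in>Pow {..<k}. measure (A (?X T I)) (?G T)) \<partial>?P)"
    by (intro Bochner_Integration.integral_sum[symmetric] measure_bind_labelled(2)[OF A] G)
  also have "\<dots> \<le> (\<integral>I. 2 ^ k * (7 / 8 + \<alpha>) \<partial>?P)"
    by (intro integral_mono point Bochner_Integration.integrable_sum measure_bind_labelled(2)[OF A] G)
      auto
  also have "\<dots> = 2 ^ k * (7 / 8 + \<alpha>)"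
    by (simp add: P.prob_space)
  finally show False using assms by simp
qed

section \<open>Choice of the constants\<close>

theorem theorem4:
  "\<exists>c0 c :: real. c0 > 0 \<and> c > 0 \<and>
     (\<forall>\<epsilon> > 0. \<exists>\<delta> > 0. \<forall>\<gamma> \<in> {0<..c0}. \<forall>\<alpha> \<in> {0<..c0}. \<forall>\<xi> \<in> {0<..c0}. \<forall>d :: nat.
        real d \<ge> 1 / \<gamma>\<^sup>2 \<longrightarrow>
        (\<forall>n H A. learner d H A \<and> differentially_private \<epsilon> \<delta> d H A \<and>
           robust_learner d \<gamma> 0 \<alpha> \<xi> n H A \<longrightarrow> real n \<ge> c / (\<epsilon> * \<gamma>\<^sup>2)))"
\<comment> \<open>The value 1/32 ensures \<open>\<alpha> + \<xi> < 1 / 8\<close> and makes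
  \<open>1 / \<gamma>\<^sup>2\<close> at least 2. The value 1/16 combines
  \<open>k < 8 * \<epsilon> * n\<close> with \<open>k \<ge> r / 2\<close>.\<close>
proof (rule exI[of _ "1/32"], rule exI[of _ "1/16"], intro conjI allI impI)
  fix \<epsilon> :: real assume \<epsilon>: "\<epsilon> > 0"
  show "\<exists>\<delta> > 0. \<forall>\<gamma> \<in> {0<..1/32}. \<forall>\<alpha> \<in> {0<..1/32}. \<forall>\<xi> \<in> {0<..1/32}. \<forall>d :: nat.
        real d \<ge> 1 / \<gamma>\<^sup>2 \<longrightarrow>
        (\<forall>n H A. learner d H A \<and> differentially_private \<epsilon> \<delta> d H A \<and>
           robust_learner d \<gamma> 0 \<alpha> \<xi> n H A \<longrightarrow> real n \<ge> (1/16) / (\<epsilon> * \<gamma>\<^sup>2))"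
  \<comment> \<open>With this \<open>\<delta>\<close>, fewer than
    \<open>1 / (2 * \<epsilon>)\<close> replacements add at most
    \<open>3 * (1 / 12) = 1 / 4\<close>.\<close>
  proof (intro exI[of _ "\<epsilon> / 12"] conjI ballI allI impI)
    fix \<gamma> \<alpha> \<xi> :: real and d n :: nat and H A
    assume \<gamma>: "\<gamma> \<in> {0<..1/32}" and \<alpha>: "\<alpha> \<in> {0<..1/32}" and \<xi>: "\<xi> \<in> {0<..1/32}"
      and d: "1 / \<gamma>\<^sup>2 \<le> real d"
      and asm: "learner d H A \<and> differentially_private \<epsilon> (\<epsilon> / 12) d H A
        \<and> robust_learner d \<gamma> 0 \<alpha> \<xi> n H A"
    define r where "r = 1 / \<gamma>\<^sup>2"
    have "\<gamma>\<^sup>2 \<le> (1 / 32)\<^sup>2" using \<gamma> by (intro power_mono) auto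
    then have r: "r \<ge> 2" using \<gamma> by (simp add: r_def field_simps power2_eq_square)
    \<comment> \<open>The largest integer strictly below \<open>r\<close>: strictness gives
      \<open>k * \<gamma>\<^sup>2 < 1\<close>, and \<open>k \<ge> r - 1 \<ge> r / 2\<close> because
      \<open>r \<ge> 2\<close>.\<close>
    define k where "k = nat (\<lceil>r\<rceil> - 1)"
    have k: "real k < r" "real k \<ge> r / 2"
      using r unfolding k_def by linarith+
    have "real k < 8 * \<epsilon> * n"
    proof (rule sample_complexity_orthonormal[where \<gamma>=\<gamma> and \<alpha>=\<alpha> and \<xi>=\<xi>])
      show "k \<le> d" using k d by (simp add: r_def)
      show "real k * \<gamma>\<^sup>2 < 1" using k \<gamma> by (simp add: r_def field_simps)
    qed (use asm \<epsilon> \<gamma> \<alpha> \<xi> k r in auto)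
    then have "r / 2 \<le> 8 * \<epsilon> * n" using k by simp
    then show "real n \<ge> (1/16) / (\<epsilon> * \<gamma>\<^sup>2)"
      using \<epsilon> \<gamma> by (simp add: r_def field_simps)
  qed (use \<epsilon> in auto)
qed auto

end
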